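(* The trigonometric Poisson–Lie bracket on $SL_n$ induces the reflection Poisson bracket on the space $\mathcal A_n$ of unipotent upper-triangular matrices, and other Poisson relations between the elements of $B$, $\mathbb A$ and $\widetilde{\mathbb A}=B\mathbb AB^{\mathrm T}$.
   Context: $\mathcal A_n$ is the space of real unipotent upper-triangular $n\times n$ matrices. $\mathcal B_n\subset SL_n$ is the set of matrices $B$ for which there is $\mathbb A\in\mathcal A_n$ with $\widetilde{\mathbb A}:=B\mathbb AB^{\mathrm T}\in\mathcal A_n$; a matrix $B\in\mathcal B_n$ determines this $\mathbb A$ (hence also $\widetilde{\mathbb A}$) uniquely, so the entries of $\mathbb A$ and $\widetilde{\mathbb A}$ are functions of $B$. The set $\mathcal B_n$ is a symplectic leaf of the Poisson–Lie bracket on $SL_n$, and "induces" refers to the brackets of these functions. Notation: $\overset{1}{X}=X\otimes\mathrm{Id}$, $\overset{2}{Y}=\mathrm{Id}\otimes Y$, $\{\overset{1}{X}\otimes\overset{2}{Y}\}=\sum_{i,j,k,l}\{X_{ij},Y_{kl}\}E_{ij}\otimes E_{kl}$ with $E_{ij}$ the matrix units. The trigonometric $r$-matrix is $r=\sum_{i,j}\theta(i-j)E_{ij}\otimes E_{ji}$, with $\theta(x)=1$ for $x>0$, $\theta(0)=1/2$, $\theta(x)=0$ for $x<0$; $r^{\mathrm T}$ is its full transpose, so that $r+r^{\mathrm T}$ is the permutation matrix, and $r^{t_2}$ is its transpose in the second tensor factor. The trigonometric Poisson–Lie bracket is $\{\overset{1}{B}\otimes\overset{2}{B}\}=-r\overset{1}{B}\overset{2}{B}+\overset{1}{B}\overset{2}{B}r$.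 The reflection Poisson bracket on $\mathcal A_n$ is $$\{\overset{1}{\mathbb A}\otimes\overset{2}{\mathbb A}\}=r\overset{1}{\mathbb A}\overset{2}{\mathbb A}-\overset{1}{\mathbb A}\overset{2}{\mathbb A}r-\overset{1}{\mathbb A}r^{t_2}\overset{2}{\mathbb A}+\overset{2}{\mathbb A}r^{t_2}\overset{1}{\mathbb A}.$$ The "other Poisson relations" meant are $$\{\overset{1}{B}\otimes\overset{2}{\mathbb A}\}=\overset{1}{B}r^{\mathrm T}\overset{2}{\mathbb A}-\overset{1}{B}\overset{2}{\mathbb A}r^{t_2},\qquad \{\overset{1}{B}\otimes\overset{2}{\widetilde{\mathbb A}}\}=r^{\mathrm T}\overset{1}{B}\overset{2}{\widetilde{\mathbb A}}-\overset{2}{\widetilde{\mathbb A}}r^{t_2}\overset{1}{B},\qquad \{\overset{1}{\mathbb A}\otimes\overset{2}{\widetilde{\mathbb A}}\}=0,$$ $$\{\overset{1}{\widetilde{\mathbb A}}\otimes\overset{2}{\widetilde{\mathbb A}}\}=-r\overset{1}{\widetilde{\mathbb A}}\overset{2}{\widetilde{\mathbb A}}+\overset{1}{\widetilde{\mathbb A}}\overset{2}{\widetilde{\mathbb A}}r+\overset{1}{\widetilde{\mathbb A}}r^{t_2}\overset{2}{\widetilde{\mathbb A}}-\overset{2}{\widetilde{\mathbb A}}r^{t_2}\overset{1}{\widetilde{\mathbb A}}.$$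
   Formalization: The r-matrix is taken as the sum of θ(j−i) E_ij⊗E_ji, since with θ(i−j) the relations fail for upper-triangular A (n=2: {A_11,A_21} would be −A_12); and the relations are stated at those B in B_n that determine A uniquely, which B=Id does not. *)

theory Defs
  imports "HOL-Analysis.Analysis"
begin

text \<open>
  An endomorphism of the tensor square of \<open>\<real>\<^sup>n\<close> is a matrix indexed by \<open>'n \<times> 'n\<close>: the entry of
  \<open>E\<^sub>i\<^sub>j \<otimes> E\<^sub>k\<^sub>l\<close> is at row \<open>(i, k)\<close>, column \<open>(j, l)\<close>.
\<close>

type_synonym 'n sqmat = "real ^ 'n ^ 'n"
type_synonym 'n tensor = "real ^ ('n \<times> 'n) ^ ('n \<times> 'n)"

definition matunit :: "'n \<Rightarrow> 'n \<Rightarrow> ('n::finite) sqmat" where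
  "matunit i j = axis i (axis j 1)"

definition tensor_prod :: "('n::finite) sqmat \<Rightarrow> 'n sqmat \<Rightarrow> 'n tensor"
  where "tensor_prod X Y = (\<chi> p q. X $ fst p $ fst q * Y $ snd p $ snd q)"

definition in1 :: "('n::finite) sqmat \<Rightarrow> 'n tensor" where
  "in1 X = tensor_prod X (mat 1)"

definition in2 :: "('n::finite) sqmat \<Rightarrow> 'n tensor" where
  "in2 Y = tensor_prod (mat 1) Y"

definition transpose2 :: "('n::finite) tensor \<Rightarrow> 'n tensor" where
  "transpose2 M = (\<chi> p q. M $ (fst p, snd q) $ (fst q, snd p))"

text \<open>\<open>theta i j\<close> is \<open>\<theta>(i - j)\<close>; only the order of the indices matters.\<close>

definition theta :: "'n::linorder \<Rightarrow> 'n \<Rightarrow> real" where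
  "theta i j = (if j < i then 1 else if i = j then 1/2 else 0)"

text \<open>
  The coefficient of \<open>E\<^sub>i\<^sub>j \<otimes> E\<^sub>j\<^sub>i\<close> in \<open>r\<close> is \<open>\<theta>(j - i)\<close>, not \<open>\<theta>(i - j)\<close>. This is the
  orientation for which the reflection bracket and the brackets of \<open>B\<close> with \<open>\<bbbA>\<close>, written with
  \<open>r\<close>, \<open>r\<^sup>T\<close> and the partial transpose in the second factor, preserve unipotent upper triangular
  matrices; the other one belongs to lower triangular matrices. Already for \<open>n = 2\<close>, with
  \<open>\<theta>(i - j)\<close> the reflection bracket of the constants \<open>\<bbbA>\<^sub>1\<^sub>1 = 1\<close> and \<open>\<bbbA>\<^sub>2\<^sub>1 = 0\<close> would be
  \<open>- \<bbbA>\<^sub>1\<^sub>2\<close>.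
\<close>

definition rmat :: "('n::{finite,linorder}) tensor" where
  "rmat = (\<Sum>i\<in>UNIV. \<Sum>j\<in>UNIV. theta j i *\<^sub>R tensor_prod (matunit i j) (matunit j i))"

definition calA :: "('n::{finite,linorder}) sqmat set" where
  "calA = {A. (\<forall>i. A $ i $ i = 1) \<and> (\<forall>i j. j < i \<longrightarrow> A $ i $ j = 0)}"

definition calB :: "('n::{finite,linorder}) sqmat set" where
  "calB = {B. det B = 1 \<and> (\<exists>A\<in>calA. B ** A ** transpose B \<in> calA)}"

text \<open>
  \<open>\<bbbA>\<close> is a function of \<open>B\<close> only where \<open>B\<close> determines it, which fails at exceptional points of
  \<open>calB\<close> (at \<open>B = mat 1\<close> every \<open>A \<in> calA\<close> is admissible). The condition is relatively open in
  \<open>calB\<close>: for fixed \<open>B\<close> the pairs \<open>(A, A')\<close> with \<open>B ** A = A' ** transpose (matrix_inv B)\<close> are the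
  solutions of an affine system, which has a unique solution iff its linear part is injective.
\<close>

definition calB_det :: "('n::{finite,linorder}) sqmat set" where
  "calB_det = {B \<in> calB. \<exists>!A. A \<in> calA \<and> B ** A ** transpose B \<in> calA}"

definition matA :: "('n::{finite,linorder}) sqmat \<Rightarrow> 'n sqmat" where
  "matA B = (THE A. A \<in> calA \<and> B ** A ** transpose B \<in> calA)"

definition matA_tilde :: "('n::{finite,linorder}) sqmat \<Rightarrow> 'n sqmat" where
  "matA_tilde B = B ** matA B ** transpose B"

primrec Ck_on :: "nat \<Rightarrow> 'a::euclidean_space set \<Rightarrow> ('a \<Rightarrow> real) \<Rightarrow> bool" where
  "Ck_on 0 U F \<longleftrightarrow> continuous_on U F"
| "Ck_on (Suc k) U F \<longleftrightarrow>
     (\<forall>x\<in>U. F differentiable (at x)) \<and>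
     (\<forall>b\<in>Basis. Ck_on k U (\<lambda>x. frechet_derivative F (at x) b))"

definition smooth_on :: "'a::euclidean_space set \<Rightarrow> ('a \<Rightarrow> real) \<Rightarrow> bool" where
  "smooth_on U F \<longleftrightarrow> (\<forall>k. Ck_on k U F)"

text \<open>
  The Poisson-Lie bracket, extended as a biderivation from the matrix entries to functions smooth
  near \<open>B\<close> in the space of all matrices. The determinant is a Casimir function, so this computes
  the bracket on \<open>SL\<^sub>n\<close> by arbitrary extension off \<open>SL\<^sub>n\<close>.
\<close>

definition pl_tensor :: "('n::{finite,linorder}) sqmat \<Rightarrow> 'n tensor" where
  "pl_tensor B = - (rmat ** in1 B ** in2 B) + in1 B ** in2 B ** rmat"

definition pl_bracket ::
  "(('n::{finite,linorder}) sqmat \<Rightarrow> real) \<Rightarrow> ('n sqmat \<Rightarrow> real) \<Rightarrow> 'n sqmat \<Rightarrow> real" where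
  "pl_bracket F G B =
     (\<Sum>i\<in>UNIV. \<Sum>j\<in>UNIV. \<Sum>k\<in>UNIV. \<Sum>l\<in>UNIV.
        pl_tensor B $ (i, k) $ (j, l)
          * frechet_derivative F (at B) (matunit i j)
          * frechet_derivative G (at B) (matunit k l))"

text \<open>
  Functions on a subset \<open>S\<close> of \<open>SL\<^sub>n\<close> are bracketed through local smooth extensions. That the
  extensions exist, and that the result does not depend on them, is part of
  \<open>has_pl_bracket\<close>.
\<close>

definition local_extension ::
  "('n::finite) sqmat set \<Rightarrow> ('n sqmat \<Rightarrow> real) \<Rightarrow> 'n sqmat \<Rightarrow> ('n sqmat \<Rightarrow> real) \<Rightarrow> bool" where
  "local_extension S f B F \<longleftrightarrow>
     (\<exists>U. open U \<and> B \<in> U \<and> smooth_on U F \<and> (\<forall>X\<in>U \<inter> S. F X = f X))"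

definition has_pl_bracket ::
  "('n::{finite,linorder}) sqmat set \<Rightarrow> ('n sqmat \<Rightarrow> real) \<Rightarrow> ('n sqmat \<Rightarrow> real)
     \<Rightarrow> 'n sqmat \<Rightarrow> real \<Rightarrow> bool" where
  "has_pl_bracket S f g B c \<longleftrightarrow>
     (\<exists>F. local_extension S f B F) \<and> (\<exists>G. local_extension S g B G) \<and>
     (\<forall>F G. local_extension S f B F \<longrightarrow> local_extension S g B G \<longrightarrow> pl_bracket F G B = c)"

text \<open>
  The tensor of brackets of the entries of the matrix-valued functions \<open>X\<close> and \<open>Y\<close> on \<open>calB_det\<close>,
  at the point \<open>B\<close>, is \<open>M\<close>.
\<close>

definition has_bracket_tensor ::
  "(('n::{finite,linorder}) sqmat \<Rightarrow> 'n sqmat) \<Rightarrow> ('n sqmat \<Rightarrow> 'n sqmat) \<Rightarrow> 'n sqmat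
     \<Rightarrow> 'n tensor \<Rightarrow> bool" where
  "has_bracket_tensor X Y B M \<longleftrightarrow>
     (\<forall>i j k l. has_pl_bracket calB_det (\<lambda>Z. X Z $ i $ j) (\<lambda>Z. Y Z $ k $ l) B
        (M $ (i, k) $ (j, l)))"

definition reflection_tensor :: "('n::{finite,linorder}) sqmat \<Rightarrow> 'n tensor" where
  "reflection_tensor A =
     rmat ** in1 A ** in2 A - in1 A ** in2 A ** rmat
       - in1 A ** transpose2 rmat ** in2 A + in2 A ** transpose2 rmat ** in1 A"

end

theory Submission
  imports Defs
begin

text \<open>
  Near a point \<open>B\<close> of \<open>calB_det\<close>, the condition that \<open>Z A Z\<^sup>T\<close> be upper triangular, with its diagonal
  left free, determines a unipotent \<open>A\<close> by a square linear system. This extends \<open>\<bbbA>\<close> and \<open>\<bbbA>'\<close>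
  rationally to all matrices near \<open>B\<close>, and \<open>calB_det\<close> is locally where the diagonal of \<open>Z A Z\<^sup>T\<close> is \<open>1\<close>
  and \<open>det Z = 1\<close>. Normalising that diagonal by scaling the rows of \<open>Z\<close> is a smooth retraction onto
  \<open>calB_det\<close>, so the derivative of a local extension in a direction fixed by the derivative of the
  retraction depends only on the function on \<open>calB_det\<close>. If \<open>X\<close> and \<open>Y\<close> are strictly upper triangular and
  \<open>V A B\<^sup>T + B X B\<^sup>T + B A V\<^sup>T = Y\<close>, then \<open>V\<close> is such a direction, and \<open>X\<close>, \<open>Y\<close> are the derivatives of
  \<open>\<bbbA>\<close>, \<open>\<bbbA>'\<close> along \<open>V\<close>. The Hamiltonian fields of the entries of \<open>B\<close>, \<open>\<bbbA>\<close> and \<open>\<bbbA>'\<close> satisfy this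
  equation with the claimed brackets as \<open>X\<close> and \<open>Y\<close>; all of them have the form
  \<open>V = B \<xi> - \<zeta> B\<close>, which makes the equation an identity of matrices.
\<close>

subsection \<open>Closure properties of smooth functions\<close>

text \<open>On an open set the derivative at a point depends only on nearby values, so the equality
  passes to all partial derivatives; hence the induction over arbitrary \<open>F\<close> and
  \<open>G\<close>.\<close>

lemma Ck_on_cong:
  assumes "open U" "\<And>x. x \<in> U \<Longrightarrow> F x = G x"
  shows "Ck_on k U F \<longleftrightarrow> Ck_on k U G"
  using assms(2)
proof (induction k arbitrary: F G)
  case 0
  then show ?case by (simp cong: continuous_on_cong)
next
  case (Suc k)
  have transfer: "H differentiable (at x) \<Longrightarrow> K differentiable (at x)"
    if "x \<in> U" "\<And>x. x \<in> U \<Longrightarrow> H x = K x" for x and H K :: "'a \<Rightarrow> real"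
    by (meson differentiable_def has_derivative_transform_within_open assms(1) that)
  have diff: "F differentiable (at x) \<longleftrightarrow> G differentiable (at x)" if "x \<in> U" for x
    using transfer[OF that, of F G] transfer[OF that, of G F] Suc.prems by auto
  have "Ck_on k U (\<lambda>x. frechet_derivative F (at x) b) \<longleftrightarrow> Ck_on k U (\<lambda>x. frechet_derivative G (at x) b)"
    if "\<forall>x\<in>U. F differentiable (at x)" for b
  proof (rule Suc.IH)
    fix x assume "x \<in> U"
    then show "frechet_derivative F (at x) b = frechet_derivative G (at x) b"
      using frechet_derivative_transform_within_open[of F x U G] that assms(1) Suc.prems by auto
  qed
  then show ?case
    using diff by auto
qed

lemma Ck_on_SucI:
  assumes "open U" "\<And>x. x \<in> U \<Longrightarrow> (F has_derivative F' x) (at x)"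
    and "\<And>b. b \<in> Basis \<Longrightarrow> Ck_on k U (\<lambda>x. F' x b)"
  shows "Ck_on (Suc k) U F"
proof -
  have "frechet_derivative F (at x) = F' x" if "x \<in> U" for x
    using frechet_derivative_at[OF assms(2)[OF that]] by simp
  then have "Ck_on k U (\<lambda>x. frechet_derivative F (at x) b) \<longleftrightarrow> Ck_on k U (\<lambda>x. F' x b)" for b
    by (intro Ck_on_cong assms(1)) simp
  moreover have "F differentiable (at x)" if "x \<in> U" for x
    using assms(2)[OF that] by (rule differentiableI)
  ultimately show ?thesis
    using assms(3) by simp
qed

lemma Ck_on_SucD:
  assumes "Ck_on (Suc k) U F"
  shows "x \<in> U \<Longrightarrow> (F has_derivative frechet_derivative F (at x)) (at x)"
    and "b \<in> Basis \<Longrightarrow> Ck_on k U (\<lambda>x. frechet_derivative F (at x) b)"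
  using assms by (simp_all add: frechet_derivative_works[symmetric])

text \<open>The product and reciprocal rules keep undifferentiated factors, to which the induction
  hypothesis applies only after lowering their order.\<close>

lemma Ck_on_Suc_imp: "Ck_on (Suc k) U F \<Longrightarrow> Ck_on k U F"
proof (induction k arbitrary: F)
  case 0
  then show ?case
    by (auto intro!: continuous_at_imp_continuous_on differentiable_imp_continuous_within)
next
  case (Suc k)
  then show ?case by (metis Ck_on.simps(2))
qed

lemma Ck_on_const: "Ck_on k U (\<lambda>_. c)"
  by (induction k arbitrary: c) auto

lemma Ck_on_linear:
  assumes "open U" "bounded_linear F" shows "Ck_on k U F"
proof (cases k)
  case 0
  then show ?thesis by (simp add: assms linear_continuous_on)
next
  case (Suc m)
  show ?thesis
    unfolding Suc
    by (rule Ck_on_SucI[OF assms(1) bounded_linear_imp_has_derivative[OF assms(2)]])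
      (rule Ck_on_const)
qed

lemma Ck_on_add:
  assumes "open U"
  shows "Ck_on k U F \<Longrightarrow> Ck_on k U G \<Longrightarrow> Ck_on k U (\<lambda>x. F x + G x)"
proof (induction k arbitrary: F G)
  case 0
  then show ?case by (simp add: continuous_on_add)
next
  case (Suc k)
  show ?case
  proof (rule Ck_on_SucI[OF assms])
    show "((\<lambda>x. F x + G x) has_derivative
        (\<lambda>h. frechet_derivative F (at x) h + frechet_derivative G (at x) h)) (at x)" if "x \<in> U" for x
      by (intro has_derivative_add Ck_on_SucD(1)[OF Suc.prems(1) that]
          Ck_on_SucD(1)[OF Suc.prems(2) that])
    show "Ck_on k U (\<lambda>x. frechet_derivative F (at x) b + frechet_derivative G (at x) b)"
      if "b \<in> Basis" for b
      by (intro Suc.IH Ck_on_SucD(2)[OF Suc.prems(1) that] Ck_on_SucD(2)[OF Suc.prems(2) that])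
  qed
qed

lemma Ck_on_mult:
  assumes "open U"
  shows "Ck_on k U F \<Longrightarrow> Ck_on k U G \<Longrightarrow> Ck_on k U (\<lambda>x. F x * G x)"
proof (induction k arbitrary: F G)
  case 0
  then show ?case by (simp add: continuous_on_mult)
next
  case (Suc k)
  have d: "((\<lambda>x. F x * G x) has_derivative
      (\<lambda>h. F x * frechet_derivative G (at x) h + frechet_derivative F (at x) h * G x)) (at x)"
    if "x \<in> U" for x
    by (intro has_derivative_mult Ck_on_SucD(1)[OF Suc.prems(1) that]
        Ck_on_SucD(1)[OF Suc.prems(2) that])
  show ?case
  proof (rule Ck_on_SucI[OF assms d])
    fix b :: 'a assume b: "b \<in> Basis"
    show "Ck_on k U (\<lambda>x. F x * frechet_derivative G (at x) b + frechet_derivative F (at x) b * G x)"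
      by (rule Ck_on_add[OF assms Suc.IH[OF Ck_on_Suc_imp[OF Suc.prems(1)] Ck_on_SucD(2)[OF Suc.prems(2) b]]
            Suc.IH[OF Ck_on_SucD(2)[OF Suc.prems(1) b] Ck_on_Suc_imp[OF Suc.prems(2)]]])
  qed
qed

lemma Ck_on_inverse:
  assumes "open U"
  shows "Ck_on k U F \<Longrightarrow> (\<And>x. x \<in> U \<Longrightarrow> F x \<noteq> 0) \<Longrightarrow> Ck_on k U (\<lambda>x. inverse (F x))"
proof (induction k arbitrary: F)
  case 0
  then show ?case by (simp add: continuous_on_inverse)
next
  case (Suc k)
  have d: "((\<lambda>x. inverse (F x)) has_derivative
      (\<lambda>h. (- 1) * ((inverse (F x) * frechet_derivative F (at x) h) * inverse (F x)))) (at x)"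
    if "x \<in> U" for x
    using Deriv.has_derivative_inverse[OF Suc.prems(2)[OF that] Ck_on_SucD(1)[OF Suc.prems(1) that]] by simp
  \<comment> \<open>The derivative of \<open>1 / F\<close> contains \<open>1 / F\<close> again, for
    which the induction hypothesis at order \<open>k\<close> is enough.\<close>
  have inv: "Ck_on k U (\<lambda>x. inverse (F x))"
    using Suc.IH[OF Ck_on_Suc_imp[OF Suc.prems(1)] Suc.prems(2)] by blast
  show ?case
  proof (rule Ck_on_SucI[OF assms d])
    fix b :: 'a assume b: "b \<in> Basis"
    show "Ck_on k U (\<lambda>x. (- 1) * ((inverse (F x) * frechet_derivative F (at x) b) * inverse (F x)))"
      by (rule Ck_on_mult[OF assms Ck_on_const Ck_on_mult[OF assms Ck_on_mult[OF assms inv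
          Ck_on_SucD(2)[OF Suc.prems(1) b]] inv]])
  qed
qed

lemma smooth_on_const: "smooth_on U (\<lambda>_. c)"
  by (simp add: smooth_on_def Ck_on_const)

lemma smooth_on_linear: "open U \<Longrightarrow> bounded_linear F \<Longrightarrow> smooth_on U F"
  by (simp add: smooth_on_def Ck_on_linear)

lemma smooth_on_add:
  "open U \<Longrightarrow> smooth_on U F \<Longrightarrow> smooth_on U G \<Longrightarrow> smooth_on U (\<lambda>x. F x + G x)"
  by (simp add: smooth_on_def Ck_on_add)

lemma smooth_on_mult:
  "open U \<Longrightarrow> smooth_on U F \<Longrightarrow> smooth_on U G \<Longrightarrow> smooth_on U (\<lambda>x. F x * G x)"
  by (simp add: smooth_on_def Ck_on_mult)

lemma smooth_on_divide:
  "open U \<Longrightarrow> smooth_on U F \<Longrightarrow> smooth_on U G \<Longrightarrow> (\<And>x. x \<in> U \<Longrightarrow> G x \<noteq> 0) \<Longrightarrow>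
    smooth_on U (\<lambda>x. F x / G x)"
  by (simp add: smooth_on_def Ck_on_mult Ck_on_inverse divide_inverse)

lemma smooth_on_sum:
  assumes "open U" "\<And>i. i \<in> I \<Longrightarrow> smooth_on U (F i)"
  shows "smooth_on U (\<lambda>x. \<Sum>i\<in>I. F i x)"
  using assms(2)
  by (induction I rule: infinite_finite_induct) (auto simp: smooth_on_const smooth_on_add assms(1))

lemma smooth_on_prod:
  assumes "open U" "\<And>i. i \<in> I \<Longrightarrow> smooth_on U (F i)"
  shows "smooth_on U (\<lambda>x. \<Prod>i\<in>I. F i x)"
  using assms(2)
  by (induction I rule: infinite_finite_induct) (auto simp: smooth_on_const smooth_on_mult assms(1))

lemma smooth_on_det:
  fixes M :: "'a::euclidean_space \<Rightarrow> real ^ 'm ^ 'm"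
  assumes "open U" "\<And>i j. smooth_on U (\<lambda>x. M x $ i $ j)"
  shows "smooth_on U (\<lambda>x. det (M x))"
  unfolding det_def
  by (intro smooth_on_sum smooth_on_mult smooth_on_prod smooth_on_const assms)

lemma smooth_on_matrix_mult:
  fixes M :: "'a::euclidean_space \<Rightarrow> real ^ 'm ^ 'k" and N :: "'a \<Rightarrow> real ^ 'l ^ 'm"
  assumes "open U" "\<And>i j. smooth_on U (\<lambda>x. M x $ i $ j)" "\<And>i j. smooth_on U (\<lambda>x. N x $ i $ j)"
  shows "smooth_on U (\<lambda>x. (M x ** N x) $ i $ j)"
  unfolding matrix_matrix_mult_def vec_lambda_beta
  by (intro smooth_on_sum smooth_on_mult assms)

lemma smooth_on_entry: "open U \<Longrightarrow> smooth_on U (\<lambda>Z :: real ^ 'm ^ 'k. Z $ i $ j)"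
  by (intro smooth_on_linear bounded_linear_compose[OF bounded_linear_vec_nth] bounded_linear_vec_nth)

lemma smooth_on_imp_continuous_on: "smooth_on U F \<Longrightarrow> continuous_on U F"
  unfolding smooth_on_def by (metis Ck_on.simps(1))

lemma smooth_on_imp_differentiable: "smooth_on U F \<Longrightarrow> x \<in> U \<Longrightarrow> F differentiable (at x)"
  unfolding smooth_on_def by (metis Ck_on.simps(2))

subsection \<open>Triangular matrices\<close>

text \<open>Supplies both the distributive laws and the product rule for derivatives of matrix
  products.\<close>

lemma bounded_bilinear_matrix_mult:
  "bounded_bilinear ((**) :: real ^ 'm ^ 'k \<Rightarrow> real ^ 'l ^ 'm \<Rightarrow> real ^ 'l ^ 'k)"
  unfolding bilinear_conv_bounded_bilinear[symmetric] bilinear_def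
  by (auto intro!: linearI simp: matrix_matrix_mult_def vec_eq_iff sum.distrib algebra_simps sum_distrib_left)

lemma bounded_linear_transpose: "bounded_linear (transpose :: real ^ 'm ^ 'k \<Rightarrow> real ^ 'k ^ 'm)"
  unfolding linear_conv_bounded_linear[symmetric]
  by (rule linearI) (simp_all add: transpose_def vec_eq_iff)

lemmas matrix_distribs =
  bounded_bilinear.add_left[OF bounded_bilinear_matrix_mult]
  bounded_bilinear.add_right[OF bounded_bilinear_matrix_mult]
  bounded_bilinear.diff_left[OF bounded_bilinear_matrix_mult]
  bounded_bilinear.diff_right[OF bounded_bilinear_matrix_mult]
  bounded_bilinear.minus_left[OF bounded_bilinear_matrix_mult]
  bounded_bilinear.minus_right[OF bounded_bilinear_matrix_mult]
  bounded_bilinear.scaleR_left[OF bounded_bilinear_matrix_mult]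
  bounded_bilinear.scaleR_right[OF bounded_bilinear_matrix_mult]

definition upper :: "('n::{finite,linorder}) sqmat \<Rightarrow> bool" where
  "upper X \<longleftrightarrow> (\<forall>i j. j < i \<longrightarrow> X $ i $ j = 0)"

text \<open>The tangent space of \<open>calA\<close>: these are the differences of two unipotent
  matrices.\<close>

definition strict_upper :: "('n::{finite,linorder}) sqmat \<Rightarrow> bool" where
  "strict_upper X \<longleftrightarrow> (\<forall>i j. j \<le> i \<longrightarrow> X $ i $ j = 0)"

lemma calA_iff: "A \<in> calA \<longleftrightarrow> (\<forall>i j. j \<le> i \<longrightarrow> A $ i $ j = mat 1 $ i $ j)"
  unfolding calA_def mat_def by (auto simp: le_less)

lemma calA_upper: "A \<in> calA \<Longrightarrow> upper A"
  by (simp add: calA_def upper_def)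

text \<open>The library's \<open>det_upperdiagonal\<close> needs an index type of class \<open>wellorder\<close>.\<close>

lemma det_upper:
  fixes X :: "('n::{finite,linorder}) sqmat"
  assumes "upper X"
  shows "det X = (\<Prod>i\<in>UNIV. X $ i $ i)"
proof -
  have "\<exists>i. p i < i" if p: "p permutes (UNIV :: 'n set)" "p \<noteq> id" for p
  proof (rule ccontr)
    assume "\<not> ?thesis"
    then have ge: "i \<le> p i" for i by (auto simp: not_less)
    \<comment> \<open>For the largest moved index \<open>i\<close>, the larger index
      \<open>p i\<close> must be fixed, which contradicts injectivity.\<close>
    define i where "i = Max {i. p i \<noteq> i}"
    have "{i. p i \<noteq> i} \<noteq> {}" using p(2) by auto
    then have i: "p i \<noteq> i" and max: "\<And>j. p j \<noteq> j \<Longrightarrow> j \<le> i"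
      using Max_in[of "{i. p i \<noteq> i}"] Max_ge[of "{i. p i \<noteq> i}"] by (auto simp: i_def)
    have "p (p i) = p i" using ge[of i] i max[of "p i"] by force
    then show False using i permutes_inj[OF p(1)] by (metis injD)
  qed
  then have "(\<Sum>p\<in>{p. p permutes (UNIV::'n set)}. of_int (sign p) * (\<Prod>i\<in>UNIV. X $ i $ p i))
      = (\<Sum>p\<in>{id}. of_int (sign p) * (\<Prod>i\<in>UNIV. X $ i $ p i))"
    using assms by (intro sum.mono_neutral_right) (auto simp: permutes_id upper_def)
  then show ?thesis
    by (simp add: det_def sign_id)
qed

lemma det_calA: "A \<in> calA \<Longrightarrow> det A = 1"
  by (simp add: det_upper[OF calA_upper]) (simp add: calA_def)

lemma matA_in:
  assumes "B \<in> calB_det"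
  shows "matA B \<in> calA" "matA_tilde B \<in> calA"
proof -
  have "\<exists>!A. A \<in> calA \<and> B ** A ** transpose B \<in> calA"
    using assms by (simp add: calB_det_def)
  from theI'[OF this] show "matA B \<in> calA" "matA_tilde B \<in> calA"
    by (simp_all add: matA_def matA_tilde_def)
qed

lemma matA_unique:
  assumes "B \<in> calB_det" "A \<in> calA" "B ** A ** transpose B \<in> calA"
  shows "A = matA B"
  using assms matA_in[OF assms(1)] by (auto simp: calB_det_def matA_tilde_def)

text \<open>
  The determinant of \<open>A + s X\<close> is constant in \<open>s\<close>, so the triangular matrix \<open>A' + s Y\<close> never has
  a zero on its diagonal. Hence \<open>Y\<close> is strictly upper triangular, and uniqueness of \<open>A\<close> applies.
\<close>

lemma calB_det_kernel:
  fixes B :: "('n::{finite,linorder}) sqmat"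
  assumes B: "B \<in> calB_det" and X: "strict_upper X" and Y: "upper (B ** X ** transpose B)"
  shows "X = 0"
proof -
  define Y where "Y = B ** X ** transpose B"
  have eq: "B ** (matA B + s *\<^sub>R X) ** transpose B = matA_tilde B + s *\<^sub>R Y" for s
    by (simp add: Y_def matA_tilde_def matrix_distribs)
  have AX: "matA B + s *\<^sub>R X \<in> calA" for s
    using matA_in(1)[OF B] X by (auto simp: calA_def strict_upper_def)
  have det: "det (matA_tilde B + s *\<^sub>R Y) = 1" for s
    using B det_calA[OF AX, of s] unfolding eq[symmetric]
    by (simp add: det_mul det_transpose calB_det_def calB_def)
  have upp: "upper (matA_tilde B + s *\<^sub>R Y)" for s
    using calA_upper[OF matA_in(2)[OF B]] Y by (simp add: upper_def Y_def)
  have diag: "Y $ i $ i = 0" for i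
  proof (rule ccontr)
    assume nz: "Y $ i $ i \<noteq> 0"
    \<comment> \<open>The diagonal of \<open>matA_tilde B\<close> is \<open>1\<close>, so this value
      of \<open>s\<close> makes the entry \<open>(i, i)\<close> vanish.\<close>
    have "(matA_tilde B + (- 1 / Y $ i $ i) *\<^sub>R Y) $ i $ i = 0"
      using nz matA_in(2)[OF B] by (simp add: calA_def)
    then have "(\<Prod>j\<in>UNIV. (matA_tilde B + (- 1 / Y $ i $ i) *\<^sub>R Y) $ j $ j) = 0"
      by (meson UNIV_I finite_class.finite_UNIV prod_zero)
    then show False
      using det[of "- 1 / Y $ i $ i"] det_upper[OF upp] by (metis zero_neq_one)
  qed
  have "B ** (matA B + 1 *\<^sub>R X) ** transpose B \<in> calA"
    unfolding eq using diag Y matA_in(2)[OF B] by (auto simp: calA_def upper_def Y_def)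
  with matA_unique[OF B AX] show "X = 0" by fastforce
qed

subsection \<open>Solving for the unipotent matrix\<close>

text \<open>
  The coefficient matrix of the square linear system in \<open>W\<close> whose equations are
  \<open>W $ i $ j = mat 1 $ i $ j\<close> for \<open>j \<le> i\<close> and \<open>(Z ** W ** transpose Z) $ j $ i = 0\<close> for \<open>i < j\<close>. Leaving the
  diagonal of \<open>Z ** W ** transpose Z\<close> free makes the system square, so that Cramer's rule extends
  \<open>matA\<close> to a neighbourhood in the space of all matrices.
\<close>

definition system_matrix :: "('n::{finite,linorder}) sqmat \<Rightarrow> real ^ ('n \<times> 'n) ^ ('n \<times> 'n)" where
  "system_matrix Z = (\<chi> p q. if snd p \<le> fst p then (if p = q then 1 else 0)
      else Z $ snd p $ fst q * Z $ fst p $ snd q)"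

definition flatten :: "('n::finite) sqmat \<Rightarrow> real ^ ('n \<times> 'n)" where
  "flatten W = (\<chi> p. W $ fst p $ snd p)"

text \<open>Cramer's rule, with the column of the unknown \<open>(i, j)\<close> replaced by the
  right-hand side. \<open>flatten (mat 1)\<close> serves both kinds of equations, since
  \<open>mat 1\<close> vanishes above the diagonal. Where the determinant is zero the value is the
  default \<open>0\<close>.\<close>

definition extA :: "('n::{finite,linorder}) sqmat \<Rightarrow> 'n sqmat" where
  "extA Z = (\<chi> i j. det (\<chi> p q. if q = (i, j) then (flatten (mat 1) :: real ^ ('n \<times> 'n)) $ p
      else system_matrix Z $ p $ q) / det (system_matrix Z))"

lemma flatten_inject: "flatten V = flatten W \<longleftrightarrow> V = W"
  by (auto simp: flatten_def vec_eq_iff)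

lemma sandwich_nth:
  fixes Z W :: "real ^ 'm ^ 'm"
  shows "(Z ** W ** transpose Z) $ i $ j = (\<Sum>q\<in>UNIV. Z $ i $ fst q * Z $ j $ snd q * W $ fst q $ snd q)"
proof -
  have "(Z ** W ** transpose Z) $ i $ j
      = (\<Sum>b\<in>UNIV. \<Sum>a\<in>UNIV. Z $ i $ a * Z $ j $ b * W $ a $ b)"
    by (simp add: matrix_matrix_mult_def transpose_def sum_distrib_right sum_distrib_left mult_ac)
  also have "\<dots> = (\<Sum>a\<in>UNIV. \<Sum>b\<in>UNIV. Z $ i $ a * Z $ j $ b * W $ a $ b)"
    by (rule sum.swap)
  finally show ?thesis
    by (simp add: sum.cartesian_product case_prod_beta UNIV_Times_UNIV)
qed

text \<open>Row \<open>(i, j)\<close> with \<open>i < j\<close> stores the equation for the mirrored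
  entry \<open>(j, i)\<close>, so that equations and unknowns share one index set.\<close>

lemma system_matrix_mult_nth:
  "(system_matrix Z *v flatten W) $ (i, j)
    = (if j \<le> i then W $ i $ j else (Z ** W ** transpose Z) $ j $ i)"
proof -
  have "(\<Sum>q\<in>UNIV. (if (i, j) = q then 1 else 0) * W $ fst q $ snd q)
      = (\<Sum>q\<in>UNIV. if (i, j) = q then W $ fst q $ snd q else 0)"
    by (rule sum.cong) auto
  then show ?thesis
    by (simp add: matrix_vector_mult_def system_matrix_def flatten_def sandwich_nth)
qed

lemma system_iff:
  "system_matrix Z *v flatten W = flatten (mat 1) \<longleftrightarrow> W \<in> calA \<and> upper (Z ** W ** transpose Z)"
  unfolding vec_eq_iff[of "_ *v _"] split_paired_All system_matrix_mult_nth calA_iff upper_def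
  by (auto simp: flatten_def mat_def not_le split: if_splits)

lemma extA_iff:
  assumes "det (system_matrix Z) \<noteq> 0"
  shows "W = extA Z \<longleftrightarrow> W \<in> calA \<and> upper (Z ** W ** transpose Z)"
proof -
  have "flatten (extA Z) = (\<chi> k. det (\<chi> p q. if q = k then flatten (mat 1) $ p
      else system_matrix Z $ p $ q) / det (system_matrix Z))"
    by (simp add: flatten_def extA_def vec_eq_iff)
  then show ?thesis
    using cramer[OF assms, of "flatten W" "flatten (mat 1)"] system_iff[of Z W] flatten_inject[of W "extA Z"]
    by metis
qed

text \<open>A kernel vector is a strictly upper triangular \<open>W\<close> with
  \<open>B ** W ** transpose B\<close> upper triangular, and \<open>calB_det_kernel\<close> forces
  it to be zero.\<close>

lemma det_system_matrix_nonzero: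
  fixes B :: "('n::{finite,linorder}) sqmat"
  assumes B: "B \<in> calB_det"
  shows "det (system_matrix B) \<noteq> 0"
proof -
  have "x = 0" if x: "system_matrix B *v x = 0" for x
  proof -
    define W :: "'n sqmat" where "W = (\<chi> i j. x $ (i, j))"
    have xW: "x = flatten W" by (simp add: W_def flatten_def vec_eq_iff)
    have "(if j \<le> i then W $ i $ j else (B ** W ** transpose B) $ j $ i) = 0" for i j
      using x unfolding xW system_matrix_mult_nth[symmetric] by simp
    then have "strict_upper W" "upper (B ** W ** transpose B)"
      by (auto simp: strict_upper_def upper_def) (metis not_le)+
    then have "W = 0" by (rule calB_det_kernel[OF B])
    then show "x = 0" by (simp add: xW flatten_def vec_eq_iff)
  qed
  then show ?thesis
    using matrix_left_invertible_ker invertible_left_inverse invertible_det_nz by metis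
qed

lemma extA_calB_det:
  assumes "B \<in> calB_det"
  shows "extA B = matA B"
  using extA_iff[OF det_system_matrix_nonzero[OF assms], of "matA B"] matA_in[OF assms]
    calA_upper[of "matA_tilde B"] by (simp add: matA_tilde_def)

subsection \<open>Smoothness\<close>

text \<open>The open domain on which Cramer's rule is valid; it is the neighbourhood used in the
  local extensions of \<open>matA\<close> and \<open>matA_tilde\<close>.\<close>

definition regular_set :: "('n::{finite,linorder}) sqmat set" where
  "regular_set = {Z. det (system_matrix Z) \<noteq> 0}"

definition extA_tilde :: "('n::{finite,linorder}) sqmat \<Rightarrow> 'n sqmat" where
  "extA_tilde Z = Z ** extA Z ** transpose Z"

lemma smooth_on_system_matrix:
  "open U \<Longrightarrow> smooth_on U (\<lambda>Z. system_matrix Z $ p $ q)"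
  by (cases "snd p \<le> fst p")
    (simp_all add: system_matrix_def smooth_on_const smooth_on_mult smooth_on_entry)

lemma open_regular_set: "open (regular_set :: ('n::{finite,linorder}) sqmat set)"
proof -
  have "continuous_on UNIV (\<lambda>Z :: 'n sqmat. det (system_matrix Z))"
    by (intro smooth_on_imp_continuous_on smooth_on_det smooth_on_system_matrix) auto
  then show ?thesis
    unfolding regular_set_def by (intro open_Collect_neq continuous_on_const)
qed

lemma smooth_on_extA: "smooth_on regular_set (\<lambda>Z. extA Z $ i $ j)"
proof -
  have "smooth_on regular_set (\<lambda>Z. if q = (i, j) then (flatten (mat 1) :: real ^ ('a \<times> 'a)) $ p
      else system_matrix Z $ p $ q)" for p q
    by (cases "q = (i, j)") (simp_all add: smooth_on_const smooth_on_system_matrix open_regular_set)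
  then show ?thesis
    unfolding extA_def vec_lambda_beta
  proof (intro smooth_on_divide smooth_on_det open_regular_set)
    show "det (system_matrix Z) \<noteq> 0" if "Z \<in> regular_set" for Z :: "'a sqmat"
      using that by (simp add: regular_set_def)
  qed (simp_all add: smooth_on_system_matrix open_regular_set)
qed

lemma smooth_on_extA_tilde: "smooth_on regular_set (\<lambda>Z. extA_tilde Z $ i $ j)"
  unfolding extA_tilde_def
  by (intro smooth_on_matrix_mult open_regular_set smooth_on_extA)
    (simp_all add: transpose_def smooth_on_entry open_regular_set)

lemma calB_det_subset_regular_set: "calB_det \<subseteq> regular_set"
  by (auto simp: regular_set_def det_system_matrix_nonzero)

lemma extA_tilde_calB_det: "B \<in> calB_det \<Longrightarrow> extA_tilde B = matA_tilde B"
  by (simp add: extA_tilde_def matA_tilde_def extA_calB_det)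

lemma local_extension_entry: "local_extension S (\<lambda>Z. Z $ i $ j) B (\<lambda>Z. Z $ i $ j)"
  unfolding local_extension_def by (intro exI[of _ UNIV]) (simp add: smooth_on_entry)

lemma local_extension_extA:
  assumes "B \<in> calB_det"
  shows "local_extension calB_det (\<lambda>Z. matA Z $ i $ j) B (\<lambda>Z. extA Z $ i $ j)"
  unfolding local_extension_def using assms calB_det_subset_regular_set
  by (intro exI[of _ regular_set]) (auto simp: open_regular_set smooth_on_extA extA_calB_det)

lemma local_extension_extA_tilde:
  assumes "B \<in> calB_det"
  shows "local_extension calB_det (\<lambda>Z. matA_tilde Z $ i $ j) B (\<lambda>Z. extA_tilde Z $ i $ j)"
  unfolding local_extension_def using assms calB_det_subset_regular_set
  by (intro exI[of _ regular_set]) (auto simp: open_regular_set smooth_on_extA_tilde extA_tilde_calB_det)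

lemma local_extension_differentiable: "local_extension S f B F \<Longrightarrow> F differentiable (at B)"
  unfolding local_extension_def by (auto intro: smooth_on_imp_differentiable)

lemma extA_in_calA:
  assumes "Z \<in> regular_set"
  shows "extA Z \<in> calA" "upper (extA_tilde Z)"
  using extA_iff[of Z "extA Z"] assms by (simp_all add: regular_set_def extA_tilde_def)

lemma has_derivative_matrix:
  fixes f :: "'a::real_normed_vector \<Rightarrow> real ^ 'm ^ 'k"
  assumes "\<And>i j. ((\<lambda>x. f x $ i $ j) has_derivative (\<lambda>h. f' h $ i $ j)) (at x)"
  shows "(f has_derivative f') (at x)"
  using assms
  by (subst has_derivative_componentwise_within) (auto simp: Basis_vec_def inner_axis)

lemma has_derivative_tendsto_nhds:
  assumes "(f has_derivative f') (at x)"
  shows "(f \<longlongrightarrow> f x) (nhds x)"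
  using has_derivative_continuous[OF assms] by (simp only: continuous_at tendsto_at_iff_tendsto_nhds)

subsection \<open>Tangent vectors\<close>

definition dextA :: "('n::{finite,linorder}) sqmat \<Rightarrow> 'n sqmat \<Rightarrow> 'n sqmat" where
  "dextA B V = (\<chi> i j. frechet_derivative (\<lambda>Z. extA Z $ i $ j) (at B) V)"

text \<open>The product rule for \<open>Z ** extA Z ** transpose Z\<close>, grouped as the nested
  bilinear rule produces it.\<close>

definition dextA_tilde :: "('n::{finite,linorder}) sqmat \<Rightarrow> 'n sqmat \<Rightarrow> 'n sqmat" where
  "dextA_tilde B V =
    B ** extA B ** transpose V + (B ** dextA B V + V ** extA B) ** transpose B"

lemma has_derivative_extA:
  assumes "B \<in> regular_set"
  shows "(extA has_derivative dextA B) (at B)"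
  using smooth_on_imp_differentiable[OF smooth_on_extA assms]
  by (intro has_derivative_matrix) (simp add: dextA_def frechet_derivative_works)

lemma has_derivative_extA_tilde:
  assumes "B \<in> regular_set"
  shows "(extA_tilde has_derivative dextA_tilde B) (at B)"
  unfolding extA_tilde_def[abs_def] dextA_tilde_def[abs_def]
  by (intro bounded_bilinear.FDERIV[OF bounded_bilinear_matrix_mult] has_derivative_extA assms
      has_derivative_ident bounded_linear.has_derivative[OF bounded_linear_transpose])

lemma has_derivative_entry:
  fixes f :: "'a::real_normed_vector \<Rightarrow> real ^ 'm ^ 'k"
  assumes "(f has_derivative f') (at x)"
  shows "((\<lambda>x. f x $ i $ j) has_derivative (\<lambda>h. f' h $ i $ j)) (at x)"
  by (intro bounded_linear.has_derivative[OF bounded_linear_vec_nth] assms)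

lemma has_derivative_locally_const:
  assumes "(f has_derivative f') (at x)" "open U" "x \<in> U" "\<And>y. y \<in> U \<Longrightarrow> f y = c"
  shows "f' h = 0"
proof -
  have "((\<lambda>_. c) has_derivative f') (at x)"
    using has_derivative_transform_within_open[OF assms] .
  then show ?thesis
    using has_derivative_unique[OF _ has_derivative_const] by metis
qed

lemma dextA_strict_upper:
  assumes "B \<in> regular_set"
  shows "strict_upper (dextA B V)"
  unfolding strict_upper_def
proof (intro allI impI)
  fix i j :: 'a assume "j \<le> i"
  then show "dextA B V $ i $ j = 0"
    using has_derivative_locally_const[OF has_derivative_entry[OF has_derivative_extA[OF assms]]
        open_regular_set assms, of i j "mat 1 $ i $ j"] extA_in_calA(1) by (auto simp: calA_iff)
qed

text \<open>The linear system leaves the diagonal of \<open>extA_tilde\<close> free, so only the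
  entries below it are forced to be constant on \<open>regular_set\<close>.\<close>

lemma dextA_tilde_upper:
  assumes "B \<in> regular_set"
  shows "upper (dextA_tilde B V)"
  unfolding upper_def
proof (intro allI impI)
  fix i j :: 'a assume "j < i"
  then show "dextA_tilde B V $ i $ j = 0"
    using has_derivative_locally_const[OF has_derivative_entry[OF has_derivative_extA_tilde[OF assms]]
        open_regular_set assms, of i j 0] extA_in_calA(2) by (auto simp: upper_def)
qed

text \<open>The linearisation of \<open>Z ** A ** transpose Z = A'\<close> at \<open>B\<close>.
  Strictness of \<open>Y\<close> says that the diagonal of \<open>A'\<close> stays \<open>1\<close>
  to first order.\<close>

definition tangent ::
  "('n::{finite,linorder}) sqmat \<Rightarrow> 'n sqmat \<Rightarrow> 'n sqmat \<Rightarrow> 'n sqmat \<Rightarrow> bool" where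
  "tangent B V X Y \<longleftrightarrow> strict_upper X \<and> strict_upper Y \<and>
    V ** matA B ** transpose B + B ** X ** transpose B + B ** matA B ** transpose V = Y"

text \<open>Both \<open>X\<close> and \<open>dextA B V\<close> solve the linearised equation. Their
  difference is strictly upper triangular with upper triangular image, hence zero by
  \<open>calB_det_kernel\<close>.\<close>

lemma tangent_derivative:
  fixes B :: "('n::{finite,linorder}) sqmat"
  assumes B: "B \<in> calB_det" and t: "tangent B V X Y"
  shows "dextA B V = X" "dextA_tilde B V = Y"
proof -
  have reg: "B \<in> regular_set"
    using B calB_det_subset_regular_set by auto
  have eq: "B ** (X - dextA B V) ** transpose B = Y - dextA_tilde B V"
    using t by (simp add: tangent_def dextA_tilde_def extA_calB_det[OF B] matrix_distribs matrix_mul_assoc)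
      (simp add: algebra_simps)
  have "strict_upper (X - dextA B V)"
    using t dextA_strict_upper[OF reg] by (simp add: tangent_def strict_upper_def)
  moreover have "upper (Y - dextA_tilde B V)"
    using t dextA_tilde_upper[OF reg] by (simp add: tangent_def strict_upper_def upper_def)
  ultimately have "X - dextA B V = 0"
    using calB_det_kernel[OF B] unfolding eq[symmetric] by blast
  then show "dextA B V = X" "dextA_tilde B V = Y"
    using eq by simp_all
qed

section \<open>Retraction onto the matrices that determine \<open>matA\<close>\<close>

text \<open>
  Scaling the rows of \<open>Z\<close> does not change \<open>extA Z\<close> and scales the diagonal of \<open>extA_tilde Z\<close>; this
  gives a retraction of a neighbourhood onto \<open>calB_det\<close>.
\<close>

definition row_scaling :: "('n::{finite,linorder}) sqmat \<Rightarrow> 'n sqmat" where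
  "row_scaling Z = (\<chi> i j. Z $ i $ j / sqrt (extA_tilde Z $ i $ i))"

lemma row_scaling_calB_det:
  assumes "B \<in> calB_det"
  shows "row_scaling B = B"
  using matA_in(2)[OF assms] by (simp add: row_scaling_def extA_tilde_calB_det[OF assms] calA_def vec_eq_iff)

lemma row_scaling_sandwich:
  "(row_scaling Z ** W ** transpose (row_scaling Z)) $ i $ j
    = (Z ** W ** transpose Z) $ i $ j / (sqrt (extA_tilde Z $ i $ i) * sqrt (extA_tilde Z $ j $ j))"
  by (simp add: sandwich_nth row_scaling_def sum_divide_distrib)

text \<open>Row scaling preserves the vanishing of the entries of
  \<open>Z ** W ** transpose Z\<close> below the diagonal, so the uniqueness in Cramer's rule for
  \<open>Z\<close> passes to the scaled matrix.\<close>

lemma row_scaling_in_calB_det: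
  assumes Z: "Z \<in> regular_set" and pos: "\<And>i. extA_tilde Z $ i $ i > 0" and det: "det Z > 0"
  shows "row_scaling Z \<in> calB_det"
proof -
  let ?R = "row_scaling Z"
  have A: "extA Z \<in> calA" by (rule extA_in_calA(1)[OF Z])
  have nz: "sqrt (extA_tilde Z $ i $ i) \<noteq> 0" for i
    using pos[of i] by simp
  have in_calA: "?R ** extA Z ** transpose ?R \<in> calA"
  proof -
    have "(?R ** extA Z ** transpose ?R) $ i $ i = 1" for i
      using pos[of i] by (simp add: row_scaling_sandwich extA_tilde_def[symmetric])
    moreover have "(?R ** extA Z ** transpose ?R) $ i $ j = 0" if "j < i" for i j
      using extA_in_calA(2)[OF Z] that
      by (simp add: row_scaling_sandwich extA_tilde_def[symmetric] upper_def)
    ultimately show ?thesis by (simp add: calA_def)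
  qed
  have "?R = (\<chi> i. (1 / sqrt (extA_tilde Z $ i $ i)) *s Z $ i)"
    by (simp add: row_scaling_def vec_eq_iff)
  then have "det ?R = (\<Prod>i\<in>UNIV. 1 / sqrt (extA_tilde Z $ i $ i)) * det Z"
    by (simp add: det_rows_mul)
  then have "det ?R > 0"
    using det pos by (simp add: prod_pos)
  \<comment> \<open>Comparing the determinants of two unipotent matrices gives only the square;
    positivity excludes \<open>-1\<close>.\<close>
  moreover have "(det ?R)\<^sup>2 = 1"
    using det_calA[OF in_calA] det_calA[OF A] by (simp add: det_mul det_transpose power2_eq_square)
  ultimately have "det ?R = 1"
    by (auto simp: power2_eq_1_iff)
  moreover have "W = extA Z" if W: "W \<in> calA" "?R ** W ** transpose ?R \<in> calA" for W
  proof -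
    have "upper (Z ** W ** transpose Z)"
      unfolding upper_def
    proof (intro allI impI)
      fix i j :: 'a assume "j < i"
      then have "(?R ** W ** transpose ?R) $ i $ j = 0"
        using W(2) by (simp add: calA_def)
      then show "(Z ** W ** transpose Z) $ i $ j = 0"
        using nz by (simp add: row_scaling_sandwich)
    qed
    then show ?thesis
      using extA_iff[of Z W] W(1) Z by (simp add: regular_set_def)
  qed
  ultimately show ?thesis
    using A in_calA by (auto simp: calB_det_def calB_def)
qed

lemma eventually_row_scaling:
  fixes B :: "('n::{finite,linorder}) sqmat"
  assumes B: "B \<in> calB_det"
  shows "\<forall>\<^sub>F Z in nhds B. row_scaling Z \<in> calB_det"
proof -
  have reg: "B \<in> regular_set"
    using B calB_det_subset_regular_set by auto
  have pos: "\<forall>\<^sub>F Z in nhds B. extA_tilde Z $ i $ i > 0" for i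
  proof -
    have "0 < extA_tilde B $ i $ i"
      using matA_in(2)[OF B] by (simp add: extA_tilde_calB_det[OF B] calA_def)
    then show ?thesis
      by (rule order_tendstoD(1)[OF has_derivative_tendsto_nhds[OF
            has_derivative_entry[OF has_derivative_extA_tilde[OF reg]]]])
  qed
  have det: "\<forall>\<^sub>F Z in nhds B. det Z > 0"
  proof -
    have "(\<lambda>Z :: 'n sqmat. det Z) differentiable (at B)"
      by (intro smooth_on_imp_differentiable[of UNIV] smooth_on_det smooth_on_entry) auto
    then have "(det \<longlongrightarrow> det B) (nhds B)"
      unfolding differentiable_def using has_derivative_tendsto_nhds by blast
    moreover have "0 < det B"
      using B by (simp add: calB_det_def calB_def)
    ultimately show ?thesis
      by (rule order_tendstoD(1))
  qed
  have "\<forall>\<^sub>F Z in nhds B. Z \<in> regular_set"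
    using open_regular_set reg by (rule eventually_nhds_in_open)
  moreover have "\<forall>\<^sub>F Z in nhds B. \<forall>i. extA_tilde Z $ i $ i > 0"
    using pos by (rule eventually_all_finite)
  ultimately show ?thesis
    using det by eventually_elim (rule row_scaling_in_calB_det, auto)
qed

text \<open>The diagonal of \<open>extA_tilde B\<close> is \<open>1\<close>, so the square root
  contributes the factor \<open>1/2\<close>. The correction vanishes on directions that fix this
  diagonal to first order.\<close>

lemma has_derivative_row_scaling:
  assumes B: "B \<in> calB_det"
  shows "(row_scaling has_derivative
    (\<lambda>h. \<chi> i j. h $ i $ j - B $ i $ j * dextA_tilde B h $ i $ i / 2)) (at B)"
proof (rule has_derivative_matrix)
  fix i j
  have reg: "B \<in> regular_set"
    using B calB_det_subset_regular_set by auto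
  have one: "extA_tilde B $ i $ i = 1"
    using matA_in(2)[OF B] by (simp add: extA_tilde_calB_det[OF B] calA_def)
  have d: "((\<lambda>Z. extA_tilde Z $ i $ i) has_derivative (\<lambda>h. dextA_tilde B h $ i $ i)) (at B)"
    by (rule has_derivative_entry[OF has_derivative_extA_tilde[OF reg]])
  have "(sqrt has_derivative (*) (1 / 2)) (at (extA_tilde B $ i $ i))"
    using DERIV_real_sqrt[of 1] by (simp add: one has_field_derivative_def)
  from has_derivative_compose[OF d this]
  have s: "((\<lambda>Z. sqrt (extA_tilde Z $ i $ i)) has_derivative (\<lambda>h. 1 / 2 * dextA_tilde B h $ i $ i)) (at B)" .
  have "((\<lambda>Z. Z $ i $ j / sqrt (extA_tilde Z $ i $ i)) has_derivative
      (\<lambda>h. h $ i $ j - B $ i $ j * dextA_tilde B h $ i $ i / 2)) (at B)"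
    using has_derivative_divide'[OF has_derivative_entry[OF has_derivative_ident] s, of i j]
    by (simp add: one)
  then show "((\<lambda>Z. row_scaling Z $ i $ j) has_derivative
      (\<lambda>h. (\<chi> i j. h $ i $ j - B $ i $ j * dextA_tilde B h $ i $ i / 2) $ i $ j)) (at B)"
    by (simp add: row_scaling_def)
qed

text \<open>Near \<open>B\<close> the composites of \<open>F\<close> and \<open>G\<close> with the
  retraction agree, and the derivative of the retraction fixes \<open>V\<close>; the chain rule then
  compares the two derivatives along \<open>V\<close>.\<close>

lemma local_extension_derivative_unique:
  assumes B: "B \<in> calB_det" and t: "tangent B V X Y"
    and F: "local_extension calB_det f B F" and G: "local_extension calB_det f B G"
  shows "frechet_derivative F (at B) V = frechet_derivative G (at B) V"
proof -
  let ?D = "\<lambda>h. \<chi> i j. h $ i $ j - B $ i $ j * dextA_tilde B h $ i $ i / 2"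
  have "dextA_tilde B V $ i $ i = 0" for i
    using t by (simp add: tangent_derivative(2)[OF B t]) (simp add: tangent_def strict_upper_def)
  then have DV: "?D V = V"
    by (simp add: vec_eq_iff)
  have comp: "((\<lambda>Z. H (row_scaling Z)) has_derivative (\<lambda>h. frechet_derivative H (at B) (?D h))) (at B)"
    if "local_extension calB_det f B H" for H
    by (rule has_derivative_compose[OF has_derivative_row_scaling[OF B]])
      (use local_extension_differentiable[OF that] in
        \<open>simp add: row_scaling_calB_det[OF B] frechet_derivative_works\<close>)
  have lim: "filterlim row_scaling (nhds B) (nhds B)"
    using has_derivative_tendsto_nhds[OF has_derivative_row_scaling[OF B]] row_scaling_calB_det[OF B]
    by simp
  have ev: "\<forall>\<^sub>F Z in nhds B. H (row_scaling Z) = f (row_scaling Z)"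
    if H: "local_extension calB_det f B H" for H
  proof -
    obtain U where U: "open U" "B \<in> U" "\<And>Z. Z \<in> U \<inter> calB_det \<Longrightarrow> H Z = f Z"
      using H unfolding local_extension_def by blast
    have "\<forall>\<^sub>F Z in nhds B. row_scaling Z \<in> U"
      using topological_tendstoD[OF lim U(1,2)] .
    with eventually_row_scaling[OF B] show ?thesis
      by eventually_elim (simp add: U(3))
  qed
  have "\<forall>\<^sub>F Z in nhds B. F (row_scaling Z) = G (row_scaling Z)"
    using ev[OF F] ev[OF G] by eventually_elim simp
  then obtain W where W: "open W" "B \<in> W" "\<And>Z. Z \<in> W \<Longrightarrow> F (row_scaling Z) = G (row_scaling Z)"
    unfolding eventually_nhds by blast
  have "(\<lambda>h. frechet_derivative F (at B) (?D h)) = (\<lambda>h. frechet_derivative G (at B) (?D h))"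
    using has_derivative_unique[OF has_derivative_transform_within_open[OF comp[OF F] W] comp[OF G]] .
  from fun_cong[OF this, of V] show ?thesis
    unfolding DV .
qed

lemma frechet_derivative_entry: "frechet_derivative (\<lambda>Z :: real ^ 'm ^ 'k. Z $ i $ j) (at B) V = V $ i $ j"
  using frechet_derivative_at[OF has_derivative_entry[OF has_derivative_ident]] by metis

text \<open>Any extension may be replaced by a canonical one: the coordinate function,
  \<open>extA\<close> or \<open>extA_tilde\<close>.\<close>

lemma tangent_extension:
  assumes "B \<in> calB_det" "tangent B V X Y"
  shows "local_extension calB_det (\<lambda>Z. Z $ i $ j) B F \<Longrightarrow> frechet_derivative F (at B) V = V $ i $ j"
    and "local_extension calB_det (\<lambda>Z. matA Z $ i $ j) B F \<Longrightarrow> frechet_derivative F (at B) V = X $ i $ j"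
    and "local_extension calB_det (\<lambda>Z. matA_tilde Z $ i $ j) B F \<Longrightarrow> frechet_derivative F (at B) V = Y $ i $ j"
proof -
  have reg: "B \<in> regular_set"
    using assms(1) calB_det_subset_regular_set by auto
  show "frechet_derivative F (at B) V = V $ i $ j" if "local_extension calB_det (\<lambda>Z. Z $ i $ j) B F"
    using local_extension_derivative_unique[OF assms that local_extension_entry]
    by (simp add: frechet_derivative_entry)
  show "frechet_derivative F (at B) V = X $ i $ j" if "local_extension calB_det (\<lambda>Z. matA Z $ i $ j) B F"
    using local_extension_derivative_unique[OF assms that local_extension_extA[OF assms(1)]]
      tangent_derivative(1)[OF assms] by (auto simp: dextA_def)
  show "frechet_derivative F (at B) V = Y $ i $ j" if "local_extension calB_det (\<lambda>Z. matA_tilde Z $ i $ j) B F"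
    using local_extension_derivative_unique[OF assms that local_extension_extA_tilde[OF assms(1)]]
      tangent_derivative(2)[OF assms]
      frechet_derivative_at[OF has_derivative_entry[OF has_derivative_extA_tilde[OF reg]]] by metis
qed

subsection \<open>Entries of the tensors\<close>

lemma sum_prod_UNIV:
  fixes f :: "'a::finite \<times> 'b::finite \<Rightarrow> real"
  shows "(\<Sum>p\<in>UNIV. f p) = (\<Sum>a\<in>UNIV. \<Sum>b\<in>UNIV. f (a, b))"
  unfolding UNIV_Times_UNIV[symmetric] by (simp only: sum.cartesian_product case_prod_eta)

text \<open>Pulls factors into Kronecker deltas so that the simplifier can collapse sums over an
  index.\<close>

lemma delta_mult:
  "(if P then a else 0) * b = (if P then a * b else (0::real))"
  "b * (if P then a else 0) = (if P then b * a else (0::real))"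
  by simp_all

lemma matrix_matrix_nth: "(M ** N) $ p $ q = (\<Sum>r\<in>UNIV. M $ p $ r * N $ r $ q)"
  by (simp add: matrix_matrix_mult_def)

lemma in1_nth: "in1 X $ (i, k) $ (j, l) = (if k = l then X $ i $ j else 0)"
  by (simp add: in1_def tensor_prod_def mat_def)

lemma in2_nth: "in2 X $ (i, k) $ (j, l) = (if i = j then X $ k $ l else 0)"
  by (simp add: in2_def tensor_prod_def mat_def)

text \<open>\<open>rmat\<close> is the flip of the two factors weighted by \<open>theta\<close>;
  multiplying by it therefore swaps two indices and introduces no sum.\<close>

lemma rmat_nth:
  "rmat $ (i, k) $ (j, l) = (if i = l then if j = k then theta j i else 0 else 0)"
proof -
  have "rmat $ (i, k) $ (j, l) = (\<Sum>a\<in>UNIV. \<Sum>b\<in>UNIV. theta b a *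
      ((if a = i then if b = j then 1 else 0 else 0) * (if b = k then if a = l then 1 else 0 else 0)))"
    unfolding rmat_def
    by (simp add: tensor_prod_def matunit_def axis_def if_distrib[of "\<lambda>x. x $ _"] if_distribR cong: if_cong)
      (intro sum.cong refl, auto simp: delta_mult)
  also have "\<dots> = (\<Sum>a\<in>UNIV. if a = i then \<Sum>b\<in>UNIV. if b = j then
      (if b = k then if a = l then theta b a else 0 else 0) else 0 else 0)"
    by (intro sum.cong refl) (auto simp: delta_mult intro!: sum.cong)
  finally show ?thesis
    by auto
qed

lemma transpose_rmat_nth:
  "transpose rmat $ (i, k) $ (j, l) = (if i = l then if j = k then theta i j else 0 else 0)"
  by (auto simp: transpose_def rmat_nth)

lemma transpose2_rmat_nth:
  "transpose2 rmat $ (i, k) $ (j, l) = (if i = k then if j = l then theta j i else 0 else 0)"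
  by (auto simp: transpose2_def rmat_nth)

lemma sum_if_UNIV: "(\<Sum>a\<in>UNIV. if P then f a else (0::real)) = (if P then \<Sum>a\<in>UNIV. f a else 0)"
  by simp

lemma in1_mult_nth: "(in1 X ** M) $ (i, k) $ q = (\<Sum>a\<in>UNIV. X $ i $ a * M $ (a, k) $ q)"
  by (simp add: matrix_matrix_nth sum_prod_UNIV in1_nth delta_mult)

lemma mult_in1_nth: "(M ** in1 X) $ p $ (j, l) = (\<Sum>a\<in>UNIV. M $ p $ (a, l) * X $ a $ j)"
  by (simp add: matrix_matrix_nth sum_prod_UNIV in1_nth delta_mult)

lemma in2_mult_nth: "(in2 X ** M) $ (i, k) $ q = (\<Sum>b\<in>UNIV. X $ k $ b * M $ (i, b) $ q)"
  by (simp add: matrix_matrix_nth sum_prod_UNIV in2_nth delta_mult sum_if_UNIV)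

lemma mult_in2_nth: "(M ** in2 X) $ p $ (j, l) = (\<Sum>b\<in>UNIV. M $ p $ (j, b) * X $ b $ l)"
  by (simp add: matrix_matrix_nth sum_prod_UNIV in2_nth delta_mult sum_if_UNIV)

lemma rmat_mult_nth: "(rmat ** M) $ (i, k) $ q = theta k i * M $ (k, i) $ q"
  by (simp add: matrix_matrix_nth sum_prod_UNIV rmat_nth delta_mult sum_if_UNIV)

lemma mult_rmat_nth: "(M ** rmat) $ p $ (j, l) = theta j l * M $ p $ (l, j)"
  by (simp add: matrix_matrix_nth sum_prod_UNIV rmat_nth delta_mult sum_if_UNIV)

lemma transpose_rmat_mult_nth: "(transpose rmat ** M) $ (i, k) $ q = theta i k * M $ (k, i) $ q"
  by (simp add: matrix_matrix_nth sum_prod_UNIV transpose_rmat_nth delta_mult sum_if_UNIV)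

lemma in1_in2_nth: "(in1 X ** in2 Y) $ (i, k) $ (j, l) = X $ i $ j * Y $ k $ l"
  by (simp add: in1_mult_nth in2_nth delta_mult)

lemma pl_tensor_nth:
  "pl_tensor B $ (i, k) $ (j, l) = (theta j l - theta k i) * B $ i $ l * B $ k $ j"
  unfolding pl_tensor_def
  by (simp add: mult_rmat_nth in1_in2_nth)
    (simp add: matrix_mul_assoc[symmetric] rmat_mult_nth in1_in2_nth algebra_simps)

lemma transpose2_sandwich_12_nth:
  "(in1 X ** transpose2 rmat ** in2 Y) $ (i, k) $ (j, l) = theta j k * X $ i $ k * Y $ j $ l"
  by (simp add: matrix_mul_assoc[symmetric] in1_mult_nth mult_in2_nth transpose2_rmat_nth delta_mult sum_if_UNIV)

lemma transpose2_sandwich_21_nth: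
  "(in2 Y ** transpose2 rmat ** in1 X) $ (i, k) $ (j, l) = theta l i * Y $ k $ i * X $ l $ j"
  by (simp add: matrix_mul_assoc[symmetric] in2_mult_nth mult_in1_nth transpose2_rmat_nth delta_mult sum_if_UNIV)

lemma reflection_tensor_nth:
  "reflection_tensor A $ (i, k) $ (j, l)
    = (theta k i - theta j l) * A $ k $ j * A $ i $ l
      - theta j k * A $ i $ k * A $ j $ l + theta l i * A $ k $ i * A $ l $ j"
  unfolding reflection_tensor_def
  by (simp add: transpose2_sandwich_12_nth transpose2_sandwich_21_nth mult_rmat_nth in1_in2_nth)
    (simp add: matrix_mul_assoc[symmetric] rmat_mult_nth in1_in2_nth algebra_simps)

definition BA_tensor :: "('n::{finite,linorder}) sqmat \<Rightarrow> 'n sqmat \<Rightarrow> 'n tensor" where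
  "BA_tensor B A = in1 B ** transpose rmat ** in2 A - in1 B ** in2 A ** transpose2 rmat"

definition BA_tilde_tensor :: "('n::{finite,linorder}) sqmat \<Rightarrow> 'n sqmat \<Rightarrow> 'n tensor" where
  "BA_tilde_tensor B A = transpose rmat ** in1 B ** in2 A - in2 A ** transpose2 rmat ** in1 B"

lemma BA_tensor_nth:
  "BA_tensor B A $ (i, k) $ (j, l)
    = (if j = k then \<Sum>a\<in>UNIV. B $ i $ a * theta a k * A $ a $ l else 0)
      - (if j = l then \<Sum>a\<in>UNIV. B $ i $ a * theta l a * A $ k $ a else 0)"
proof -
  have "(in1 B ** transpose rmat ** in2 A) $ (i, k) $ (j, l)
      = (if j = k then \<Sum>a\<in>UNIV. B $ i $ a * theta a k * A $ a $ l else 0)"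
    by (simp add: matrix_mul_assoc[symmetric] in1_mult_nth transpose_rmat_mult_nth in2_nth delta_mult
        sum_if_UNIV mult_ac)
  moreover have "(in1 B ** in2 A ** transpose2 rmat) $ (i, k) $ (j, l)
      = (if j = l then \<Sum>a\<in>UNIV. B $ i $ a * theta l a * A $ k $ a else 0)"
    by (simp add: matrix_mul_assoc[symmetric] in1_mult_nth in2_mult_nth transpose2_rmat_nth delta_mult
        sum_if_UNIV mult_ac)
  ultimately show ?thesis
    by (simp add: BA_tensor_def)
qed

lemma BA_tilde_tensor_nth:
  "BA_tilde_tensor B A $ (i, k) $ (j, l)
    = theta i k * B $ k $ j * A $ i $ l - theta l i * A $ k $ i * B $ l $ j"
  unfolding BA_tilde_tensor_def
  by (simp add: transpose2_sandwich_21_nth)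
    (simp add: matrix_mul_assoc[symmetric] transpose_rmat_mult_nth in1_in2_nth)

subsection \<open>Hamiltonian vector fields\<close>

text \<open>The entrywise form of \<open>r + r^T\<close> being the permutation matrix.\<close>

lemma theta_add_flip: "theta i j + theta j i = 1"
  by (auto simp: theta_def)

text \<open>\<open>theta a i\<close> vanishes unless \<open>i \<le> a\<close>, and
  \<open>A $ a $ j\<close> unless \<open>a \<le> j\<close>; in the last claim both sides survive
  only for \<open>a = i\<close>.\<close>

lemma theta_calA:
  assumes "A \<in> calA"
  shows "j < i \<Longrightarrow> theta a i * A $ a $ j = 0"
    and "j < i \<Longrightarrow> theta j a * A $ i $ a = 0"
    and "theta a i * A $ a $ i = theta i a * A $ i $ a"
  using assms by (auto simp: theta_def calA_def)

text \<open>Inserting \<open>V = B xi - zeta B\<close> cancels every term in \<open>xi\<close> and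
  leaves \<open>B A M B^T - zeta A' - A' zeta^T\<close>; the relation between \<open>M\<close> and
  \<open>N\<close> turns the first term into \<open>A' N\<close>.\<close>

lemma tangent_gauge:
  fixes B xi zeta M N :: "('n::{finite,linorder}) sqmat"
  assumes "M ** transpose B = transpose B ** N"
    and "X = matA B ** M - xi ** matA B - matA B ** transpose xi"
    and "Y = matA_tilde B ** N - zeta ** matA_tilde B - matA_tilde B ** transpose zeta"
    and "strict_upper X" "strict_upper Y"
  shows "tangent B (B ** xi - zeta ** B) X Y"
proof -
  have "B ** (matA B ** M) ** transpose B = B ** matA B ** transpose B ** N"
    by (simp add: matrix_mul_assoc[symmetric] assms(1))
  moreover have "transpose (B ** xi - zeta ** B) = transpose xi ** transpose B - transpose B ** transpose zeta"
    by (simp add: matrix_transpose_mul[symmetric]) (simp add: transpose_def vec_eq_iff)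
  ultimately show ?thesis
    using assms(4,5) unfolding tangent_def matA_tilde_def assms(2,3)
    by (simp add: matrix_distribs matrix_mul_assoc)
qed

text \<open>The Hamiltonian field \<open>{-, B_kl}\<close>: its entry \<open>(i, j)\<close> is the
  bracket of \<open>B_ij\<close> with \<open>B_kl\<close>.\<close>

definition BB_field :: "('n::{finite,linorder}) sqmat \<Rightarrow> 'n \<Rightarrow> 'n \<Rightarrow> 'n sqmat" where
  "BB_field B k l = (\<chi> i j. pl_tensor B $ (i, k) $ (j, l))"

definition BA_field :: "('n::{finite,linorder}) sqmat \<Rightarrow> 'n \<Rightarrow> 'n \<Rightarrow> 'n sqmat" where
  "BA_field B k l = (\<chi> i j. BA_tensor B (matA B) $ (i, k) $ (j, l))"

definition BA_tilde_field :: "('n::{finite,linorder}) sqmat \<Rightarrow> 'n \<Rightarrow> 'n \<Rightarrow> 'n sqmat" where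
  "BA_tilde_field B k l = (\<chi> i j. BA_tilde_tensor B (matA_tilde B) $ (i, k) $ (j, l))"

lemma BB_field_flip: "BB_field B k l $ i $ j = - BB_field B i j $ k $ l"
proof -
  have flip: "theta j l = 1 - theta l j" "theta k i = 1 - theta i k"
    using theta_add_flip[of j l] theta_add_flip[of k i] by simp_all
  show ?thesis
    by (simp add: BB_field_def pl_tensor_nth flip) (simp add: algebra_simps)
qed

lemma strict_upperI:
  assumes "\<And>i j. j < i \<Longrightarrow> X $ i $ j = 0" "\<And>i. X $ i $ i = 0"
  shows "strict_upper X"
  unfolding strict_upper_def using assms by (metis le_less)

text \<open>The derivative of \<open>A_ij\<close> along \<open>{-, B_kl}\<close> should be
  \<open>{A_ij, B_kl} = - {B_kl, A_ij}\<close>, whence the minus signs.\<close>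

lemma tangent_BB_field:
  fixes B :: "('n::{finite,linorder}) sqmat"
  assumes B: "B \<in> calB_det"
  shows "tangent B (BB_field B k l) (\<chi> i j. - BA_field B i j $ k $ l) (\<chi> i j. - BA_tilde_field B i j $ k $ l)"
proof -
  let ?A = "matA B" and ?T = "matA_tilde B"
  \<comment> \<open>\<open>xi\<close> and \<open>zeta\<close> are read off from the two terms of
    \<open>pl_tensor\<close>. \<open>M = B^T E_kl\<close> and \<open>N = E_kl B^T\<close> absorb the
    \<open>1\<close> left over when the arguments of \<open>theta\<close> are exchanged.\<close>
  define xi :: "'n sqmat" where "xi = (\<chi> i j. if i = l then theta j l * B $ k $ j else 0)"
  define zeta :: "'n sqmat" where "zeta = (\<chi> i j. if j = k then theta k i * B $ i $ l else 0)"
  define M :: "'n sqmat" where "M = (\<chi> i j. if j = l then B $ k $ i else 0)"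
  define N :: "'n sqmat" where "N = (\<chi> i j. if i = k then B $ j $ l else 0)"
  have "BB_field B k l = B ** xi - zeta ** B"
    by (simp add: BB_field_def vec_eq_iff pl_tensor_nth matrix_matrix_nth xi_def zeta_def delta_mult)
      (simp add: algebra_simps)
  moreover have "tangent B (B ** xi - zeta ** B)
      (\<chi> i j. - BA_field B i j $ k $ l) (\<chi> i j. - BA_tilde_field B i j $ k $ l)"
  proof (rule tangent_gauge)
    show "M ** transpose B = transpose B ** N"
      by (simp add: vec_eq_iff matrix_matrix_nth M_def N_def transpose_def delta_mult)
    have flip: "theta a l = 1 - theta l a" "theta k a = 1 - theta a k" for a
      using theta_add_flip[of a l] theta_add_flip[of a k] by simp_all
    show "(\<chi> i j. - BA_field B i j $ k $ l) = ?A ** M - xi ** ?A - ?A ** transpose xi"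
      by (auto simp: BA_field_def vec_eq_iff BA_tensor_nth matrix_matrix_nth M_def xi_def transpose_def
          delta_mult sum_if_UNIV flip algebra_simps sum_subtractf sum.distrib)
    show "(\<chi> i j. - BA_tilde_field B i j $ k $ l) = ?T ** N - zeta ** ?T - ?T ** transpose zeta"
      by (auto simp: BA_tilde_field_def vec_eq_iff BA_tilde_tensor_nth matrix_matrix_nth N_def zeta_def
          transpose_def delta_mult flip(2) algebra_simps)
    note A = theta_calA[OF matA_in(1)[OF B]] and T = theta_calA[OF matA_in(2)[OF B]]
    show "strict_upper (\<chi> i j. - BA_field B i j $ k $ l)"
      by (rule strict_upperI) (simp_all add: BA_field_def BA_tensor_nth mult.assoc A)
    show "strict_upper (\<chi> i j. - BA_tilde_field B i j $ k $ l)"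
    proof (rule strict_upperI)
      fix i j :: 'n assume "j < i"
      then have "theta k i * ?T $ k $ j = 0" "theta j k * ?T $ i $ k = 0"
        using T by auto
      then show "(\<chi> i j. - BA_tilde_field B i j $ k $ l) $ i $ j = 0"
        by (auto simp: BA_tilde_field_def BA_tilde_tensor_nth)
    next
      fix i
      show "(\<chi> i j. - BA_tilde_field B i j $ k $ l) $ i $ i = 0"
        using T(3)[of k i] by (simp add: BA_tilde_field_def BA_tilde_tensor_nth)
    qed
  qed
  ultimately show ?thesis by simp
qed

text \<open>The entries of \<open>A\<close> on and below the diagonal are constants, so their
  brackets must vanish. Below the diagonal each term is zero; on it the terms cancel in
  pairs.\<close>

lemma strict_upper_reflection_tensor:
  assumes "A \<in> calA"
  shows "strict_upper (\<chi> i j. reflection_tensor A $ (i, k) $ (j, l))"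
proof (rule strict_upperI)
  note A = theta_calA[OF assms]
  fix i j :: 'a assume "j < i"
  then have "theta k i * A $ k $ j = 0" "theta j l * A $ i $ l = 0" "theta j k * A $ i $ k = 0"
    "theta l i * A $ l $ j = 0"
    using A by auto
  then show "(\<chi> i j. reflection_tensor A $ (i, k) $ (j, l)) $ i $ j = 0"
    by (auto simp: reflection_tensor_nth)
next
  note A = theta_calA[OF assms]
  fix i
  show "(\<chi> i j. reflection_tensor A $ (i, k) $ (j, l)) $ i $ i = 0"
    unfolding vec_lambda_beta reflection_tensor_nth using A(3)[of k i] A(3)[of l i] by algebra
qed

text \<open>Every term of \<open>BA_tensor\<close> has the left factor \<open>B\<close>, so
  \<open>zeta = 0\<close>: the field is an infinitesimal right multiplication, which changes
  \<open>A\<close> and fixes \<open>A'\<close>.\<close>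

lemma tangent_BA_field:
  fixes B :: "('n::{finite,linorder}) sqmat"
  assumes B: "B \<in> calB_det"
  shows "tangent B (BA_field B k l) (\<chi> i j. reflection_tensor (matA B) $ (i, k) $ (j, l)) 0"
proof -
  let ?A = "matA B"
  define xi :: "'n sqmat" where "xi = (\<chi> i j. (if j = k then theta i k * ?A $ i $ l else 0)
    - (if j = l then theta l i * ?A $ k $ i else 0))"
  have "BA_field B k l = B ** xi - 0 ** B"
    by (simp add: BA_field_def vec_eq_iff BA_tensor_nth matrix_matrix_nth xi_def right_diff_distrib
        sum_subtractf delta_mult sum_if_UNIV mult.assoc)
  moreover have "tangent B (B ** xi - 0 ** B) (\<chi> i j. reflection_tensor ?A $ (i, k) $ (j, l)) 0"
  proof (rule tangent_gauge[where M = 0 and N = 0])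
    have flip: "theta k a = 1 - theta a k" "theta a l = 1 - theta l a" for a
      using theta_add_flip[of a l] theta_add_flip[of a k] by simp_all
    show "(\<chi> i j. reflection_tensor ?A $ (i, k) $ (j, l)) = ?A ** 0 - xi ** ?A - ?A ** transpose xi"
      by (simp add: vec_eq_iff reflection_tensor_nth matrix_matrix_nth xi_def transpose_def
          right_diff_distrib left_diff_distrib sum_subtractf delta_mult flip)
    show "strict_upper (\<chi> i j. reflection_tensor ?A $ (i, k) $ (j, l))"
      by (rule strict_upper_reflection_tensor[OF matA_in(1)[OF B]])
  qed (simp_all add: strict_upper_def transpose_def vec_eq_iff matrix_matrix_nth)
  ultimately show ?thesis by simp
qed

text \<open>The mirror case \<open>xi = 0\<close>: an infinitesimal left multiplication changes
  \<open>A'\<close> and fixes \<open>A\<close>.\<close>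

lemma tangent_BA_tilde_field:
  fixes B :: "('n::{finite,linorder}) sqmat"
  assumes B: "B \<in> calB_det"
  shows "tangent B (BA_tilde_field B k l) 0 (\<chi> i j. - reflection_tensor (matA_tilde B) $ (i, k) $ (j, l))"
proof -
  let ?T = "matA_tilde B"
  define zeta :: "'n sqmat" where "zeta = (\<chi> i j. (if j = l then theta l i * ?T $ k $ i else 0)
    - (if j = k then theta i k * ?T $ i $ l else 0))"
  have "BA_tilde_field B k l = B ** 0 - zeta ** B"
    by (simp add: BA_tilde_field_def vec_eq_iff BA_tilde_tensor_nth matrix_matrix_nth zeta_def
        left_diff_distrib sum_subtractf delta_mult)
  moreover have "tangent B (B ** 0 - zeta ** B) 0 (\<chi> i j. - reflection_tensor ?T $ (i, k) $ (j, l))"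
  proof (rule tangent_gauge[where M = 0 and N = 0])
    have flip: "theta k a = 1 - theta a k" "theta a l = 1 - theta l a" for a
      using theta_add_flip[of a l] theta_add_flip[of a k] by simp_all
    show "(\<chi> i j. - reflection_tensor ?T $ (i, k) $ (j, l)) = ?T ** 0 - zeta ** ?T - ?T ** transpose zeta"
      by (simp add: vec_eq_iff reflection_tensor_nth matrix_matrix_nth zeta_def transpose_def
          right_diff_distrib left_diff_distrib sum_subtractf delta_mult flip)
    show "strict_upper (\<chi> i j. - reflection_tensor ?T $ (i, k) $ (j, l))"
      using strict_upper_reflection_tensor[OF matA_in(2)[OF B], of k l] by (simp add: strict_upper_def)
  qed (simp_all add: strict_upper_def transpose_def vec_eq_iff matrix_matrix_nth)
  ultimately show ?thesis by simp
qed

section \<open>Brackets computed from tangent fields\<close>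

lemma linear_matunit:
  fixes f :: "('n::finite) sqmat \<Rightarrow> real"
  assumes "linear f"
  shows "f V = (\<Sum>i\<in>UNIV. \<Sum>j\<in>UNIV. V $ i $ j * f (matunit i j))"
proof -
  have "V = (\<Sum>i\<in>UNIV. \<Sum>j\<in>UNIV. V $ i $ j *\<^sub>R matunit i j)"
  proof -
    have "(\<Sum>a\<in>UNIV. \<Sum>b\<in>UNIV. V $ a $ b * matunit a b $ i $ j)
        = (\<Sum>a\<in>UNIV. if a = i then \<Sum>b\<in>UNIV. if b = j then V $ a $ b else 0 else 0)" for i j
      by (intro sum.cong refl) (auto simp: matunit_def axis_def delta_mult intro!: sum.cong)
    then show ?thesis
      by (simp add: vec_eq_iff)
  qed
  then have "f V = f (\<Sum>i\<in>UNIV. \<Sum>j\<in>UNIV. V $ i $ j *\<^sub>R matunit i j)"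
    by (rule arg_cong)
  also have "\<dots> = (\<Sum>i\<in>UNIV. \<Sum>j\<in>UNIV. V $ i $ j * f (matunit i j))"
    by (simp add: linear_sum[OF assms] linear_cmul[OF assms])
  finally show ?thesis .
qed

lemma local_extension_linear: "local_extension S f B F \<Longrightarrow> linear (frechet_derivative F (at B))"
  using local_extension_differentiable linear_frechet_derivative by blast

text \<open>\<open>BB_field B a b\<close> is the field of \<open>B_ab\<close>, so the derivative of
  \<open>G\<close> along it is \<open>{G, B_ab} = - {B_ab, G}\<close>. The last hypothesis thus says
  that \<open>V\<close> is the Hamiltonian field of \<open>G\<close>.\<close>

lemma pl_bracket_field:
  assumes F: "linear (frechet_derivative F (at B))" and G: "linear (frechet_derivative G (at B))"
    and V: "\<And>a b. frechet_derivative G (at B) (BB_field B a b) = - V $ a $ b"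
  shows "pl_bracket F G B = frechet_derivative F (at B) V"
proof -
  have "V $ i $ j = (\<Sum>k\<in>UNIV. \<Sum>l\<in>UNIV. pl_tensor B $ (i, k) $ (j, l)
      * frechet_derivative G (at B) (matunit k l))" for i j
  proof -
    have "V $ i $ j = - frechet_derivative G (at B) (BB_field B i j)"
      by (simp add: V)
    also have "\<dots> = (\<Sum>k\<in>UNIV. \<Sum>l\<in>UNIV. - BB_field B i j $ k $ l
      * frechet_derivative G (at B) (matunit k l))"
      by (simp add: linear_matunit[OF G, of "BB_field B i j"] sum_negf)
    also have "\<dots> = (\<Sum>k\<in>UNIV. \<Sum>l\<in>UNIV. pl_tensor B $ (i, k) $ (j, l)
      * frechet_derivative G (at B) (matunit k l))"
      unfolding BB_field_flip[symmetric] by (simp add: BB_field_def)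
    finally show ?thesis .
  qed
  then show ?thesis
    unfolding pl_bracket_def linear_matunit[OF F, of V]
    by (simp add: sum_distrib_left sum_distrib_right mult_ac)
qed

text \<open>\<open>V k l\<close> is the candidate field of the entry \<open>(k, l)\<close> of
  \<open>Y\<close>: the third premise identifies it through the fields of the entries of
  \<open>B\<close>, the fourth differentiates \<open>X\<close> along it.\<close>

lemma has_bracket_tensorI:
  assumes "\<And>i j. \<exists>F. local_extension calB_det (\<lambda>Z. X Z $ i $ j) B F"
    and "\<And>k l. \<exists>G. local_extension calB_det (\<lambda>Z. Y Z $ k $ l) B G"
    and "\<And>k l a b G. local_extension calB_det (\<lambda>Z. Y Z $ k $ l) B G \<Longrightarrow>
      frechet_derivative G (at B) (BB_field B a b) = - V k l $ a $ b"
    and "\<And>i j k l F. local_extension calB_det (\<lambda>Z. X Z $ i $ j) B F \<Longrightarrow>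
      frechet_derivative F (at B) (V k l) = M $ (i, k) $ (j, l)"
  shows "has_bracket_tensor X Y B M"
  unfolding has_bracket_tensor_def has_pl_bracket_def
proof (intro allI conjI impI assms(1,2))
  fix i j k l F G
  assume F: "local_extension calB_det (\<lambda>Z. X Z $ i $ j) B F"
    and G: "local_extension calB_det (\<lambda>Z. Y Z $ k $ l) B G"
  show "pl_bracket F G B = M $ (i, k) $ (j, l)"
    using pl_bracket_field[OF local_extension_linear[OF F] local_extension_linear[OF G] assms(3)[OF G]]
      assms(4)[OF F] by metis
qed

theorem theorem2p6:
  fixes B :: "('n::{finite,linorder}) sqmat"
  assumes "B \<in> calB_det"
  shows "has_bracket_tensor (\<lambda>Z. Z) (\<lambda>Z. Z) B (pl_tensor B)
    \<and> has_bracket_tensor matA matA B (reflection_tensor (matA B))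
    \<and> has_bracket_tensor (\<lambda>Z. Z) matA B
        (in1 B ** transpose rmat ** in2 (matA B) - in1 B ** in2 (matA B) ** transpose2 rmat)
    \<and> has_bracket_tensor (\<lambda>Z. Z) matA_tilde B
        (transpose rmat ** in1 B ** in2 (matA_tilde B)
          - in2 (matA_tilde B) ** transpose2 rmat ** in1 B)
    \<and> has_bracket_tensor matA matA_tilde B 0
    \<and> has_bracket_tensor matA_tilde matA_tilde B
        (- (rmat ** in1 (matA_tilde B) ** in2 (matA_tilde B))
          + in1 (matA_tilde B) ** in2 (matA_tilde B) ** rmat
          + in1 (matA_tilde B) ** transpose2 rmat ** in2 (matA_tilde B)
          - in2 (matA_tilde B) ** transpose2 rmat ** in1 (matA_tilde B))"
proof -
  note ext = local_extension_entry local_extension_extA[OF assms] local_extension_extA_tilde[OF assms]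
  \<comment> \<open>In each of these lists the facts 1, 2 and 3 differentiate extensions of the
    entries of \<open>B\<close>, \<open>matA\<close> and \<open>matA_tilde\<close> along the
    field.\<close>
  note BB = tangent_extension[OF assms tangent_BB_field[OF assms]]
  note BA = tangent_extension[OF assms tangent_BA_field[OF assms]]
  note BT = tangent_extension[OF assms tangent_BA_tilde_field[OF assms]]
  have tilde: "- (rmat ** in1 (matA_tilde B) ** in2 (matA_tilde B))
          + in1 (matA_tilde B) ** in2 (matA_tilde B) ** rmat
          + in1 (matA_tilde B) ** transpose2 rmat ** in2 (matA_tilde B)
          - in2 (matA_tilde B) ** transpose2 rmat ** in1 (matA_tilde B)
      = - reflection_tensor (matA_tilde B)"
    by (simp add: reflection_tensor_def)
  show ?thesis
    unfolding tilde BA_tensor_def[symmetric] BA_tilde_tensor_def[symmetric]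
  proof (intro conjI)
    show "has_bracket_tensor (\<lambda>Z. Z) (\<lambda>Z. Z) B (pl_tensor B)"
      by (rule has_bracket_tensorI[where V = "BB_field B"])
        (use ext in blast, use ext in blast, simp_all only: BB(1) BB_field_flip[symmetric], simp add: BB_field_def)
    show "has_bracket_tensor matA matA B (reflection_tensor (matA B))"
      by (rule has_bracket_tensorI[where V = "BA_field B"])
        (use ext in blast, use ext in blast, simp_all add: BB(2) BA(2))
    show "has_bracket_tensor (\<lambda>Z. Z) matA B (BA_tensor B (matA B))"
      by (rule has_bracket_tensorI[where V = "BA_field B"])
        (use ext in blast, use ext in blast, simp_all add: BB(2) BA(1), simp add: BA_field_def)
    show "has_bracket_tensor (\<lambda>Z. Z) matA_tilde B (BA_tilde_tensor B (matA_tilde B))"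
      by (rule has_bracket_tensorI[where V = "BA_tilde_field B"])
        (use ext in blast, use ext in blast, simp_all add: BB(3) BT(1), simp add: BA_tilde_field_def)
    \<comment> \<open>By \<open>BT(2)\<close>, the fields of the entries of
      \<open>matA_tilde\<close> annihilate all entries of \<open>matA\<close>.\<close>
    show "has_bracket_tensor matA matA_tilde B 0"
      by (rule has_bracket_tensorI[where V = "BA_tilde_field B"])
        (use ext in blast, use ext in blast, simp_all add: BB(3) BT(2))
    show "has_bracket_tensor matA_tilde matA_tilde B (- reflection_tensor (matA_tilde B))"
      by (rule has_bracket_tensorI[where V = "BA_tilde_field B"])
        (use ext in blast, use ext in blast, simp_all add: BB(3) BT(3))
  qed
qed

end
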